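(* Let $X$ be a non-negative random variable with absolutely continuous distribution function $F$ and finite mean. Then the Gini mean difference of $X$ satisfies $GMD=2\,CRT_2(X)$, where $CRT_2(X)$ is the cumulative residual Tsallis entropy of order $2$.
   Context: $\bar F(x)=P(X>x)$. The Gini mean difference is $GMD=E|X_1-X_2|$, where $X_1,X_2$ are independent with distribution function $F$. The cumulative residual Tsallis entropy of order $\alpha>0$, $\alpha\neq1$, is $$CRT_\alpha(X)=\frac{1}{\alpha-1}\int_0^\infty\big(\bar F(x)-\bar F^\alpha(x)\big)\,dx.$$ *)

theory Defs
  imports "HOL-Probability.Probability"
begin

text \<open>
  Absolute continuity of a real function on the whole line, in the epsilon-delta sense.
  The library predicate \<open>absolutely_continuous\<close> is a relation between measures instead.
\<close>

definition absolutely_continuous_fun :: "(real \<Rightarrow> real) \<Rightarrow> bool" where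
  "absolutely_continuous_fun F \<longleftrightarrow>
    (\<forall>\<epsilon>>0. \<exists>\<delta>>0. \<forall>(n::nat) a b.
      (\<forall>i<n. a i \<le> b i) \<longrightarrow>
      disjoint_family_on (\<lambda>i. {a i<..<b i}) {..<n} \<longrightarrow>
      (\<Sum>i<n. b i - a i) < \<delta> \<longrightarrow>
      (\<Sum>i<n. \<bar>F (b i) - F (a i)\<bar>) < \<epsilon>)"

definition survival :: "'a measure \<Rightarrow> ('a \<Rightarrow> real) \<Rightarrow> real \<Rightarrow> real" where
  "survival M X x = measure M {\<omega> \<in> space M. X \<omega> > x}"

definition cum_residual_tsallis :: "'a measure \<Rightarrow> real \<Rightarrow> ('a \<Rightarrow> real) \<Rightarrow> real" where
  "cum_residual_tsallis M \<alpha> X =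
    1 / (\<alpha> - 1) * (LINT x:{0..}|lborel. survival M X x - survival M X x powr \<alpha>)"

end

theory Submission
  imports Defs
begin

text \<open>
  The distance \<open>\<bar>X1 - X2\<bar>\<close> is the length of the interval between \<open>X1\<close> and \<open>X2\<close>.
  By Tonelli, its mean is the integral over all thresholds \<open>x\<close> of the probability that \<open>x\<close>
  separates \<open>X1\<close> from \<open>X2\<close>, which by independence is \<open>2 (S x - S x ^ 2)\<close> for the survival
  function \<open>S\<close>; this vanishes for \<open>x < 0\<close>.
\<close>

text \<open>Working with nonnegative integrals makes the exchange of the two integrations available
  from measurability and sigma-finiteness alone. Neither independence nor a probability space enters
  yet.\<close>

lemma nn_integral_abs_diff_eq_threshold:
  fixes Y Z :: "'b \<Rightarrow> real"
  assumes "sigma_finite_measure N"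
    and [measurable]: "Y \<in> borel_measurable N" "Z \<in> borel_measurable N"
  shows "(\<integral>\<^sup>+\<omega>. ennreal \<bar>Y \<omega> - Z \<omega>\<bar> \<partial>N) =
    (\<integral>\<^sup>+x. emeasure N {\<omega> \<in> space N. min (Y \<omega>) (Z \<omega>) \<le> x \<and> x < max (Y \<omega>) (Z \<omega>)} \<partial>lborel)"
proof -
  interpret sigma_finite_measure N by fact
  interpret P: pair_sigma_finite N "lborel :: real measure" ..
  \<comment> \<open>The interval is closed on the left and open on the right, so that the two sides
    of the threshold are exactly the events measured by \<open>cdf\<close> (\<le>) and
    \<open>survival\<close> (>), with no exceptional set for ties.\<close>
  let ?f = "\<lambda>\<omega> x::real. indicator {(\<omega>, x). min (Y \<omega>) (Z \<omega>) \<le> x \<and> x < max (Y \<omega>) (Z \<omega>)} (\<omega>, x) :: ennreal"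
  have [measurable]: "case_prod ?f \<in> borel_measurable (N \<Otimes>\<^sub>M lborel)"
    by (simp add: indicator_def case_prod_beta)
  have "(\<integral>\<^sup>+\<omega>. ennreal \<bar>Y \<omega> - Z \<omega>\<bar> \<partial>N) = (\<integral>\<^sup>+\<omega>. \<integral>\<^sup>+x. ?f \<omega> x \<partial>lborel \<partial>N)"
  proof (intro nn_integral_cong)
    fix \<omega>
    have "(\<integral>\<^sup>+x. ?f \<omega> x \<partial>lborel) = (\<integral>\<^sup>+x. indicator {min (Y \<omega>) (Z \<omega>)..<max (Y \<omega>) (Z \<omega>)} x \<partial>lborel)"
      by (intro nn_integral_cong) (auto simp: indicator_def)
    also have "\<dots> = ennreal (max (Y \<omega>) (Z \<omega>) - min (Y \<omega>) (Z \<omega>))"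
      by simp
    also have "max (Y \<omega>) (Z \<omega>) - min (Y \<omega>) (Z \<omega>) = \<bar>Y \<omega> - Z \<omega>\<bar>"
      by (auto simp: max_def min_def)
    finally show "ennreal \<bar>Y \<omega> - Z \<omega>\<bar> = (\<integral>\<^sup>+x. ?f \<omega> x \<partial>lborel)" ..
  qed
  also have "\<dots> = (\<integral>\<^sup>+x. \<integral>\<^sup>+\<omega>. ?f \<omega> x \<partial>N \<partial>lborel)"
    by (rule P.Fubini'[symmetric]) measurable
  also have "\<dots> = (\<integral>\<^sup>+x. emeasure N {\<omega> \<in> space N. min (Y \<omega>) (Z \<omega>) \<le> x \<and> x < max (Y \<omega>) (Z \<omega>)} \<partial>lborel)"
  proof (intro nn_integral_cong)
    fix x
    have "(\<integral>\<^sup>+\<omega>. ?f \<omega> x \<partial>N) =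
      (\<integral>\<^sup>+\<omega>. indicator {\<omega> \<in> space N. min (Y \<omega>) (Z \<omega>) \<le> x \<and> x < max (Y \<omega>) (Z \<omega>)} \<omega> \<partial>N)"
      by (intro nn_integral_cong) (auto simp: indicator_def)
    then show "(\<integral>\<^sup>+\<omega>. ?f \<omega> x \<partial>N) = emeasure N {\<omega> \<in> space N. min (Y \<omega>) (Z \<omega>) \<le> x \<and> x < max (Y \<omega>) (Z \<omega>)}"
      by simp
  qed
  finally show ?thesis .
qed

lemma (in prob_space) survival_eq_cdf:
  assumes [measurable]: "X \<in> borel_measurable M"
  shows "survival M X x = 1 - cdf (distr M borel X) x"
proof -
  have "cdf (distr M borel X) x = prob {\<omega> \<in> space M. X \<omega> \<le> x}"
    by (auto simp: cdf_def measure_distr intro!: arg_cong[where f = prob])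
  moreover have "prob {\<omega> \<in> space M. \<not> X \<omega> \<le> x} = 1 - prob {\<omega> \<in> space M. X \<omega> \<le> x}"
    by (rule prob_neg) measurable
  ultimately show ?thesis
    by (simp add: survival_def not_le)
qed

text \<open>A threshold separates the two values in one of two ways, according to which variable
  stays below it. These cases are disjoint, and each is a rectangle event, whose probability factors
  by independence.\<close>

lemma (in prob_space) prob_threshold_between:
  fixes Y Z :: "'a \<Rightarrow> real"
  assumes ind: "indep_var borel Y borel Z"
  shows "prob {\<omega> \<in> space M. min (Y \<omega>) (Z \<omega>) \<le> x \<and> x < max (Y \<omega>) (Z \<omega>)} =
    cdf (distr M borel Y) x * survival M Z x + survival M Y x * cdf (distr M borel Z) x"
proof -
  have [measurable]: "Y \<in> borel_measurable M" "Z \<in> borel_measurable M"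
    using indep_var_rv1[OF ind] indep_var_rv2[OF ind] by auto
  have gt: "survival M V x = prob (V -` {x<..} \<inter> space M)" for V :: "'a \<Rightarrow> real"
    unfolding survival_def by (rule arg_cong[where f = prob]) auto
  have le: "cdf (distr M borel V) x = prob (V -` {..x} \<inter> space M)"
    if "V \<in> borel_measurable M" for V :: "'a \<Rightarrow> real"
    using that by (simp add: cdf_def measure_distr)
  let ?A = "(\<lambda>\<omega>. (Y \<omega>, Z \<omega>)) -` ({..x} \<times> {x<..}) \<inter> space M"
  let ?B = "(\<lambda>\<omega>. (Y \<omega>, Z \<omega>)) -` ({x<..} \<times> {..x}) \<inter> space M"
  have "{\<omega> \<in> space M. min (Y \<omega>) (Z \<omega>) \<le> x \<and> x < max (Y \<omega>) (Z \<omega>)} = ?A \<union> ?B"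
    by auto
  also have "prob \<dots> = prob ?A + prob ?B"
    by (rule finite_measure_Union) auto
  also have "prob ?A = prob (Y -` {..x} \<inter> space M) * prob (Z -` {x<..} \<inter> space M)"
    by (rule indep_varD[OF ind]) auto
  also have "prob ?B = prob (Y -` {x<..} \<inter> space M) * prob (Z -` {..x} \<inter> space M)"
    by (rule indep_varD[OF ind]) auto
  finally show ?thesis
    by (simp add: gt le)
qed

theorem mainTheorem5:
  fixes M :: "'a measure" and X :: "'a \<Rightarrow> real"
    and N :: "'b measure" and X1 X2 :: "'b \<Rightarrow> real"
  assumes "prob_space M"
    and "X \<in> borel_measurable M"
    and nonneg: "AE \<omega> in M. 0 \<le> X \<omega>"
    and abs_cont: "absolutely_continuous_fun (cdf (distr M borel X))"
    and finite_mean: "integrable M X"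
    and "prob_space N"
    and indep: "prob_space.indep_var N borel X1 borel X2"
    and X1: "cdf (distr N borel X1) = cdf (distr M borel X)"
    and X2: "cdf (distr N borel X2) = cdf (distr M borel X)"
  shows "(\<integral>\<omega>. \<bar>X1 \<omega> - X2 \<omega>\<bar> \<partial>N) = 2 * cum_residual_tsallis M 2 X"
proof -
  interpret M: prob_space M by fact
  interpret N: prob_space N by fact
  note [measurable] = \<open>X \<in> borel_measurable M\<close>
  have [measurable]: "X1 \<in> borel_measurable N" "X2 \<in> borel_measurable N"
    using N.indep_var_rv1[OF indep] N.indep_var_rv2[OF indep] by auto
  define S where "S = survival M X"
  have cdf: "cdf (distr M borel X) x = 1 - S x" for x
    by (simp add: S_def M.survival_eq_cdf)
  have surv: "survival N X1 x = S x" "survival N X2 x = S x" for x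
    by (simp_all add: N.survival_eq_cdf X1 X2 cdf)
  have S_nonneg: "0 \<le> S x" and S_le_1: "S x \<le> 1" for x
    by (simp_all add: S_def survival_def)
  \<comment> \<open>Since \<open>X\<close> is nonnegative almost surely, it exceeds a negative
    \<open>x\<close> almost surely. Hence \<open>S x - S x ^ 2\<close> vanishes left of 0, which
    later confines the integral to \<open>{0..}\<close>.\<close>
  have S_neg: "S x = 1" if "x < 0" for x
    unfolding S_def survival_def
    by (subst M.prob_Collect_eq_1) (use nonneg that in \<open>auto elim!: eventually_mono\<close>)
  \<comment> \<open>\<open>S\<close> is decreasing, so measurability comes from the monotone
    function \<open>- S\<close>.\<close>
  have "mono (\<lambda>x. - S x)"
    unfolding S_def survival_def
    by (intro monoI le_imp_neg_le M.finite_measure_mono) auto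
  then have "(\<lambda>x. - S x) \<in> borel_measurable borel"
    by (rule borel_measurable_mono)
  then have [measurable]: "S \<in> borel_measurable borel"
    by simp
  define g where "g x = 2 * (S x - S x ^ 2)" for x
  have [measurable]: "g \<in> borel_measurable borel"
    unfolding g_def by measurable
  have g_nonneg: "0 \<le> g x" for x
    using mult_left_le[OF S_le_1 S_nonneg, of x x] by (simp add: g_def power2_eq_square)
  have "(\<integral>\<omega>. \<bar>X1 \<omega> - X2 \<omega>\<bar> \<partial>N) = enn2real (\<integral>\<^sup>+\<omega>. ennreal \<bar>X1 \<omega> - X2 \<omega>\<bar> \<partial>N)"
    by (rule integral_eq_nn_integral) auto
  \<comment> \<open>With the common distribution, the separation probability is
    \<open>(1 - S x) * S x + S x * (1 - S x)\<close>, which is \<open>g x\<close>.\<close>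
  also have "(\<integral>\<^sup>+\<omega>. ennreal \<bar>X1 \<omega> - X2 \<omega>\<bar> \<partial>N) = (\<integral>\<^sup>+x. ennreal (g x) \<partial>lborel)"
    by (subst nn_integral_abs_diff_eq_threshold)
       (auto intro!: nn_integral_cong N.sigma_finite_measure_axioms
         simp: N.emeasure_eq_measure N.prob_threshold_between[OF indep] X1 X2 cdf surv g_def
           algebra_simps power2_eq_square)
  also have "enn2real \<dots> = (\<integral>x. g x \<partial>lborel)"
    by (rule integral_eq_nn_integral[symmetric]) (auto simp: g_nonneg)
  \<comment> \<open>The indicator is harmless because \<open>g\<close> is 0 on the negative axis;
    \<open>S_nonneg\<close> turns the square into \<open>powr 2\<close>, including where
    \<open>S x\<close> is 0.\<close>
  also have "\<dots> = (\<integral>x. 2 * (indicator {0..} x *\<^sub>R (S x - S x powr 2)) \<partial>lborel)"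
    by (intro Bochner_Integration.integral_cong)
       (auto simp: g_def indicator_def S_neg S_nonneg powr_numeral)
  \<comment> \<open>At order 2 the prefactor \<open>1 / (\<alpha> - 1)\<close> equals 1.\<close>
  also have "\<dots> = 2 * cum_residual_tsallis M 2 X"
    by (simp add: cum_residual_tsallis_def set_lebesgue_integral_def S_def)
  finally show ?thesis .
qed

end
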